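(* Consider a \(b^2\)-Bucket Sort algorithm as described in the context, and let \(T_{b^2}(X)\) be its running time on input \(X\). Let \(X\) consist of \(n\) keys chosen independently and uniformly at random from \([0,1)\), and let \(R_{b^2}(t) = -\ln \Pr[T_{b^2}(X) \ge \mathbb{E}[T_{b^2}(X)] + t]\). Then there exists a constant \(C>0\) such that for every constant \(c > C\), \(R_{b^2}(cn) = \Theta(\sqrt{n}\log n)\) as \(n\to\infty\).
   Context: Bucket Sort on \(n\) keys \(X=\{x_1,\dots,x_n\}\subset[0,1)\): distribute the keys into \(n\) buckets, bucket \(j\in\{0,\dots,n-1\}\) consisting of the keys in \([j/n,(j+1)/n)\); sort the keys of each bucket; then scan the buckets in increasing order and output the keys. Let \(B_j\) be the number of keys in bucket \(j\). A \(b^2\)-Bucket Sort sorts each bucket of \(b\) keys with a deterministic comparison sorting algorithm taking \(\Theta(b^2)\) time (e.g. Insertion Sort), so that its running time satisfies \(T_{b^2}(X)=\Theta\big(n+\sum_{j=0}^{n-1} B_j^2\big)\), i.e. there are constants \(0<c_1\le c_2\) with \(c_1(n+\sum_j B_j^2)\le T_{b^2}(X)\le c_2(n+\sum_j B_j^2)\) for all inputs and all sufficiently large \(n\). The constant \(C\) may depend on \(c_1,c_2\). \(\log\) denotes base-2 logarithm and \(\ln\) the natural logarithm. *)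

theory Defs
  imports "HOL-Probability.Probability" "HOL-Library.Landau_Symbols"
begin

text \<open>
  An input of size \<open>n\<close> is a family \<open>x 0, \<dots>, x (n - 1)\<close> of keys in \<open>[0, 1)\<close>.  Lebesgue measure
  restricted to \<open>[0, 1)\<close> is the uniform distribution on \<open>[0, 1)\<close>, so the product below is the law of
  \<open>n\<close> independent uniform keys, and its underlying space is exactly the set of inputs of size \<open>n\<close>.
\<close>
definition uniform_keys :: "nat \<Rightarrow> (nat \<Rightarrow> real) measure" where
  "uniform_keys n = Pi\<^sub>M {..<n} (\<lambda>_. restrict_space lborel {0..<1})"

lemma space_uniform_keys: "space (uniform_keys n) = {..<n} \<rightarrow>\<^sub>E {0..<1}"
  by (simp add: uniform_keys_def space_PiM space_restrict_space)

lemma prob_space_uniform_keys: "prob_space (uniform_keys n)"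
  unfolding uniform_keys_def
proof (rule prob_space_PiM)
  show "prob_space (restrict_space lborel {0..<1::real})"
    by (rule prob_spaceI) (simp add: emeasure_restrict_space space_restrict_space)
qed

definition bucket_count :: "nat \<Rightarrow> (nat \<Rightarrow> real) \<Rightarrow> nat \<Rightarrow> nat" where
  "bucket_count n x j = card {i \<in> {..<n}. x i \<in> {real j / real n ..< real (j + 1) / real n}}"

text \<open>
  \<open>T n x\<close> is the running time on the input \<open>x\<close> of size \<open>n\<close>.  Measurability says that the running
  time on random keys is a random variable; it is automatic for a deterministic comparison-based
  algorithm, whose running time depends only on the bucket indices and the relative order of the keys.
\<close>
definition b2_bucket_sort_time ::
    "real \<Rightarrow> real \<Rightarrow> (nat \<Rightarrow> (nat \<Rightarrow> real) \<Rightarrow> real) \<Rightarrow> bool" where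
  "b2_bucket_sort_time c\<^sub>1 c\<^sub>2 T \<longleftrightarrow>
     (\<forall>n. T n \<in> borel_measurable (uniform_keys n)) \<and>
     (\<forall>\<^sub>F n in sequentially. \<forall>x \<in> space (uniform_keys n).
        c\<^sub>1 * (real n + (\<Sum>j<n. (real (bucket_count n x j))\<^sup>2)) \<le> T n x \<and>
        T n x \<le> c\<^sub>2 * (real n + (\<Sum>j<n. (real (bucket_count n x j))\<^sup>2)))"

text \<open>
  Since \<open>ln 0 = 0\<close>, the value is \<open>0\<close> rather than infinity when the tail event is null; either value
  rules out growth of a positive order.
\<close>
definition tail_rate :: "(nat \<Rightarrow> (nat \<Rightarrow> real) \<Rightarrow> real) \<Rightarrow> nat \<Rightarrow> real \<Rightarrow> real" where
  "tail_rate T n t =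
     - ln (measure (uniform_keys n)
         {x \<in> space (uniform_keys n). T n x \<ge> integral\<^sup>L (uniform_keys n) (T n) + t})"

end

theory Submission
  imports Defs "HOL-Real_Asymp.Real_Asymp"
begin

text \<open>
  The bucket sizes \<open>B\<^sub>0, \<dots>, B\<^sub>n\<^sub>-\<^sub>1\<close> are the fibre sizes of a uniformly random map between sets of \<open>n\<close>
  elements, and \<open>n + \<Sum>B\<^sub>j\<^sup>2\<close> has mean at most \<open>3n\<close>.

  The tail is at least of order \<open>exp (- O(sqrt n ln n))\<close> because the first \<open>m \<approx> K sqrt n\<close> keys all
  fall into bucket 0 with probability \<open>n\<^sup>-\<^sup>m\<close>, and then \<open>\<Sum>B\<^sub>j\<^sup>2 \<ge> K\<^sup>2 n\<close>.

  For the converse, the second moment is replaced by \<open>\<Sum>h(B\<^sub>j)\<close> with \<open>h(b) = min (b\<^sup>2 / sqrt n) b\<close>: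
  if \<open>\<Sum>B\<^sub>j\<^sup>2 \<ge> 2 L\<^sup>2 n\<close> then \<open>\<Sum>h(B\<^sub>j) \<ge> L sqrt n\<close>.  Comparing the multinomial law with independent
  Poisson variables of mean 1 costs only a factor \<open>n! e\<^sup>n / n\<^sup>n = O(n)\<close>.  With \<open>\<mu> = ln n / 4\<close> one has
  \<open>\<mu> h(b) \<le> b (ln b + 1) / 2\<close>, about half of \<open>ln b!\<close>, so the Poisson moment of \<open>exp (\<mu> h)\<close> is at
  most \<open>1 + M \<mu> / sqrt n\<close> for a constant \<open>M\<close>, and Markov's inequality gives
  \<open>O(n) exp (- \<mu> (L - M) sqrt n)\<close>.
\<close>

subsection \<open>Bucket indices of uniform keys\<close>

text \<open>Restricting to \<open>{..<n}\<close> makes the value extensional, hence a point of the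
  finite set \<open>{..<n} \<rightarrow>\<^sub>E {..<n}\<close>, over which probabilities become
  counts.\<close>

definition bucket_index :: "nat \<Rightarrow> (nat \<Rightarrow> real) \<Rightarrow> nat \<Rightarrow> nat" where
  "bucket_index n x = (\<lambda>i\<in>{..<n}. nat \<lfloor>real n * x i\<rfloor>)"

definition fibre_card :: "'a set \<Rightarrow> ('a \<Rightarrow> 'b) \<Rightarrow> 'b \<Rightarrow> nat" where
  "fibre_card A f j = card {i \<in> A. f i = j}"

lemma bucket_iff_floor:
  assumes "0 < n" "0 \<le> y"
  shows "y \<in> {real j / real n ..< real (j + 1) / real n} \<longleftrightarrow> nat \<lfloor>real n * y\<rfloor> = j"
proof -
  have "nat \<lfloor>real n * y\<rfloor> = j \<longleftrightarrow> \<lfloor>real n * y\<rfloor> = int j"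
    using assms by (auto simp: nat_eq_iff)
  also have "\<dots> \<longleftrightarrow> real j \<le> real n * y \<and> real n * y < real j + 1"
    by (simp add: floor_eq_iff)
  finally show ?thesis
    using assms by (auto simp: field_simps)
qed

lemma bucket_index_in:
  assumes "x \<in> space (uniform_keys n)"
  shows "bucket_index n x \<in> {..<n} \<rightarrow>\<^sub>E {..<n}"
proof (cases "n = 0")
  case False
  have "nat \<lfloor>real n * x i\<rfloor> < n" if "i < n" for i
  proof -
    have "0 \<le> x i" "x i < 1"
      using assms that by (auto simp: space_uniform_keys PiE_iff)
    then have "real n * x i < real n"
      using False by simp
    then have "\<lfloor>real n * x i\<rfloor> < int n"
      by (simp add: floor_less_iff)
    then show ?thesis
      using False by linarith
  qed
  then show ?thesis
    by (auto simp: bucket_index_def)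
qed (auto simp: bucket_index_def)

lemma bucket_count_eq_fibre_card:
  assumes "0 < n" "x \<in> space (uniform_keys n)"
  shows "bucket_count n x j = fibre_card {..<n} (bucket_index n x) j"
proof -
  have "0 \<le> x i" if "i < n" for i
    using assms(2) that by (auto simp: space_uniform_keys PiE_iff)
  then have "{i \<in> {..<n}. x i \<in> {real j / real n ..< real (j + 1) / real n}}
      = {i \<in> {..<n}. bucket_index n x i = j}"
    using bucket_iff_floor[OF assms(1)] by (auto simp: bucket_index_def simp del: atLeastLessThan_iff)
  then show ?thesis
    by (simp add: bucket_count_def fibre_card_def)
qed

text \<open>Prescribing all indices confines the keys to a box whose sides are buckets of length
  1/n. Every map thus has the same probability: the index map is uniform on all n^n maps.\<close>

lemma measure_bucket_index_fibre:
  assumes n: "0 < n" and f: "f \<in> {..<n} \<rightarrow>\<^sub>E {..<n}"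
  defines "A \<equiv> {x \<in> space (uniform_keys n). bucket_index n x = f}"
  shows "A \<in> sets (uniform_keys n)" and "measure (uniform_keys n) A = 1 / real n ^ n"
proof -
  let ?U = "restrict_space lborel {0..<1::real}"
  let ?I = "\<lambda>i. {real (f i) / real n ..< real (f i + 1) / real n}"
  interpret U: prob_space ?U
    by (rule prob_spaceI) (simp add: emeasure_restrict_space space_restrict_space)
  interpret P: finite_product_prob_space "\<lambda>_. ?U" "{..<n}"
    by unfold_locales auto
  have sub: "?I i \<subseteq> {0..<1}" if "i < n" for i
  proof -
    have "f i < n"
      using f that by auto
    then have "real (f i + 1) / real n \<le> 1"
      using n by (simp add: divide_simps)
    then show ?thesis
      by (auto intro: order_trans[rotated])
  qed
  have A: "A = Pi\<^sub>E {..<n} ?I"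
  proof (intro set_eqI iffI)
    fix x assume "x \<in> A"
    then have x: "x \<in> {..<n} \<rightarrow>\<^sub>E {0..<1}" and e: "bucket_index n x = f"
      by (auto simp: A_def space_uniform_keys)
    have "x i \<in> ?I i" if "i < n" for i
    proof (subst bucket_iff_floor[OF n])
      show "0 \<le> x i"
        using x that by (auto simp: PiE_iff)
      show "nat \<lfloor>real n * x i\<rfloor> = f i"
        using e that by (auto simp: bucket_index_def)
    qed
    with x show "x \<in> Pi\<^sub>E {..<n} ?I"
      by (auto simp: PiE_iff)
  next
    fix x assume x: "x \<in> Pi\<^sub>E {..<n} ?I"
    have x1: "x i \<in> {0..<1}" if "i < n" for i
      using PiE_mem[OF x, of i] sub[OF that] that by blast
    have "bucket_index n x i = f i" for i
    proof (cases "i < n")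
      case True
      with x have "x i \<in> ?I i"
        by (auto simp: PiE_iff)
      with bucket_iff_floor[OF n, of "x i" "f i"] x1[OF True] True show ?thesis
        by (simp add: bucket_index_def)
    qed (use f in \<open>auto simp: bucket_index_def PiE_iff extensional_def\<close>)
    with x x1 show "x \<in> A"
      by (auto simp: A_def space_uniform_keys PiE_iff)
  qed
  have I: "?I i \<in> sets ?U" if "i < n" for i
    using sub[OF that] by (auto simp: sets_restrict_space_iff)
  show "A \<in> sets (uniform_keys n)"
    unfolding A uniform_keys_def using I by (intro sets_PiM_I_finite) auto
  have m: "measure ?U (?I i) = 1 / real n" if "i < n" for i
    using sub[OF that] n by (simp add: measure_restrict_space field_simps)
  have "measure (uniform_keys n) A = (\<Prod>i\<in>{..<n}. measure ?U (?I i))"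
    unfolding A uniform_keys_def using I by (intro P.finite_measure_PiM_emb) auto
  also have "\<dots> = (\<Prod>i\<in>{..<n}. 1 / real n)"
    using m by (intro prod.cong) auto
  finally show "measure (uniform_keys n) A = 1 / real n ^ n"
    by (simp add: power_one_over)
qed

text \<open>The integrand is a simple function, one value per index map, so integrability and the
  expectation as a plain average come together.\<close>

lemma has_bochner_integral_bucket_index:
  fixes \<phi> :: "(nat \<Rightarrow> nat) \<Rightarrow> real"
  assumes n: "0 < n"
  shows "has_bochner_integral (uniform_keys n) (\<lambda>x. \<phi> (bucket_index n x))
           ((\<Sum>f\<in>{..<n} \<rightarrow>\<^sub>E {..<n}. \<phi> f) / real n ^ n)"
proof -
  let ?F = "{..<n} \<rightarrow>\<^sub>E {..<n}"
  let ?A = "\<lambda>f. {x \<in> space (uniform_keys n). bucket_index n x = f}"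
  interpret prob_space "uniform_keys n"
    by (rule prob_space_uniform_keys)
  have fin: "finite ?F"
    by (intro finite_PiE) auto
  have "has_bochner_integral (uniform_keys n) (\<lambda>x. \<Sum>f\<in>?F. \<phi> f * indicator (?A f) x)
          (\<Sum>f\<in>?F. \<phi> f * measure (uniform_keys n) (?A f))"
    using measure_bucket_index_fibre(1)[OF n] emeasure_finite
    by (intro has_bochner_integral_sum has_bochner_integral_mult_right
        has_bochner_integral_real_indicator) (auto simp: less_top[symmetric])
  also have "(\<Sum>f\<in>?F. \<phi> f * measure (uniform_keys n) (?A f)) = (\<Sum>f\<in>?F. \<phi> f) / real n ^ n"
    using measure_bucket_index_fibre(2)[OF n] by (simp add: sum_divide_distrib)
  finally have *: "has_bochner_integral (uniform_keys n)
      (\<lambda>x. \<Sum>f\<in>?F. \<phi> f * indicator (?A f) x) ((\<Sum>f\<in>?F. \<phi> f) / real n ^ n)" .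
  have "(\<Sum>f\<in>?F. \<phi> f * indicator (?A f) x) = \<phi> (bucket_index n x)"
    if x: "x \<in> space (uniform_keys n)" for x
  proof -
    have "(\<Sum>f\<in>?F. \<phi> f * indicator (?A f) x) = (\<Sum>f\<in>?F. if f = bucket_index n x then \<phi> f else 0)"
      using x by (intro sum.cong) (auto simp: indicator_def)
    then show ?thesis
      using bucket_index_in[OF x] fin by simp
  qed
  with * show ?thesis
    by (subst has_bochner_integral_cong[OF refl _ refl]) auto
qed

lemma measure_bucket_index:
  assumes n: "0 < n"
  defines "A \<equiv> \<lambda>P. {x \<in> space (uniform_keys n). P (bucket_index n x)}"
  shows "A P \<in> sets (uniform_keys n)"
    and "measure (uniform_keys n) (A P)
      = real (card {f \<in> {..<n} \<rightarrow>\<^sub>E {..<n}. P f}) / real n ^ n"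
proof -
  let ?F = "{..<n} \<rightarrow>\<^sub>E {..<n}"
  interpret prob_space "uniform_keys n"
    by (rule prob_space_uniform_keys)
  have fin: "finite ?F"
    by (intro finite_PiE) auto
  have *: "has_bochner_integral (uniform_keys n) (\<lambda>x. of_bool (P (bucket_index n x)))
      ((\<Sum>f\<in>?F. of_bool (P f)) / real n ^ n)"
    by (rule has_bochner_integral_bucket_index[OF n, of "\<lambda>f. of_bool (P f)"])
  have "A P = (\<lambda>x. of_bool (P (bucket_index n x)) :: real) -` {1} \<inter> space (uniform_keys n)"
    by (auto simp: A_def)
  also have "\<dots> \<in> sets (uniform_keys n)"
    using borel_measurable_has_bochner_integral[OF *] by (rule measurable_sets) auto
  finally show AP: "A P \<in> sets (uniform_keys n)" .
  have "measure (uniform_keys n) (A P) = integral\<^sup>L (uniform_keys n) (indicator (A P))"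
    using AP by (simp add: sets.sets_into_space Int_absorb2)
  also have "\<dots> = (\<integral>x. of_bool (P (bucket_index n x)) \<partial>uniform_keys n)"
    by (rule Bochner_Integration.integral_cong) (auto simp: A_def indicator_def)
  also have "\<dots> = (\<Sum>f\<in>?F. of_bool (P f)) / real n ^ n"
    using * by (rule has_bochner_integral_integral_eq)
  also have "(\<Sum>f\<in>?F. of_bool (P f)) = real (card {f \<in> ?F. P f})"
    using fin by (simp add: Int_def)
  finally show "measure (uniform_keys n) (A P) = real (card {f \<in> ?F. P f}) / real n ^ n" .
qed

subsection \<open>Fibre sizes of maps between finite sets\<close>

text \<open>Both sides count the ordered pairs of points with the same image. In this form the mean
  needs only pairwise collision probabilities.\<close>

lemma sum_fibre_card_squares:
  assumes A: "finite A" and J: "finite J" and f: "f \<in> A \<rightarrow> J"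
  shows "(\<Sum>j\<in>J. (real (fibre_card A f j))\<^sup>2) = (\<Sum>i\<in>A. \<Sum>k\<in>A. of_bool (f i = f k))"
proof -
  have "(\<Sum>j\<in>J. (real (fibre_card A f j))\<^sup>2) = (\<Sum>j\<in>J. (\<Sum>i\<in>A. of_bool (f i = j))\<^sup>2)"
    using A by (simp add: fibre_card_def Int_def)
  also have "\<dots> = (\<Sum>j\<in>J. \<Sum>i\<in>A. \<Sum>k\<in>A. of_bool (f i = j) * of_bool (f k = j))"
    by (simp add: power2_eq_square sum_product)
  also have "\<dots> = (\<Sum>i\<in>A. \<Sum>k\<in>A. \<Sum>j\<in>J. of_bool (f i = j) * of_bool (f k = j))"
    by (subst sum.swap, intro sum.cong refl, subst sum.swap) simp
  also have "\<dots> = (\<Sum>i\<in>A. \<Sum>k\<in>A. of_bool (f i = f k))"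
  proof (intro sum.cong refl)
    fix i k assume "i \<in> A" "k \<in> A"
    have "(\<Sum>j\<in>J. of_bool (f i = j) * of_bool (f k = j))
        = (\<Sum>j\<in>J. if j = f i then of_bool (f k = j) else (0::real))"
      by (intro sum.cong) auto
    also have "\<dots> = of_bool (f k = f i)"
      using J f \<open>i \<in> A\<close> by (auto simp: Pi_iff)
    finally show "(\<Sum>j\<in>J. of_bool (f i = j) * of_bool (f k = j)) = (of_bool (f i = f k) :: real)"
      by (simp add: eq_commute)
  qed
  finally show ?thesis .
qed

text \<open>For each common value \<open>v\<close> the maps form a box with two coordinates frozen,
  and these boxes are disjoint. The product form avoids division and covers empty
  \<open>J\<close>.\<close>

lemma card_PiE_collision:
  assumes A: "finite A" and J: "finite J" and "i \<in> A" "k \<in> A" "i \<noteq> k"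
  shows "card {f \<in> A \<rightarrow>\<^sub>E J. f i = f k} * card J = card J ^ card A"
proof -
  let ?X = "\<lambda>v l. if l = i \<or> l = k then {v} else J"
  have "{f \<in> A \<rightarrow>\<^sub>E J. f i = f k} = (\<Union>v\<in>J. Pi\<^sub>E A (?X v))"
  proof (intro set_eqI iffI)
    fix f assume "f \<in> {f \<in> A \<rightarrow>\<^sub>E J. f i = f k}"
    then have "f \<in> Pi\<^sub>E A (?X (f i))" "f i \<in> J"
      using assms by (auto simp: PiE_iff)
    then show "f \<in> (\<Union>v\<in>J. Pi\<^sub>E A (?X v))"
      by blast
  next
    fix f assume "f \<in> (\<Union>v\<in>J. Pi\<^sub>E A (?X v))"
    then obtain v where v: "v \<in> J" and f: "f \<in> Pi\<^sub>E A (?X v)"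
      by blast
    have "f l \<in> ?X v l" if "l \<in> A" for l
      using f that by (rule PiE_mem)
    then have "f l \<in> J" if "l \<in> A" for l
      using that v by (metis (full_types) singletonD)
    moreover have "f i = v" "f k = v"
      using PiE_mem[OF f \<open>i \<in> A\<close>] PiE_mem[OF f \<open>k \<in> A\<close>] by auto
    ultimately show "f \<in> {f \<in> A \<rightarrow>\<^sub>E J. f i = f k}"
      using f by (auto simp: PiE_iff)
  qed
  also have "card \<dots> = (\<Sum>v\<in>J. card (Pi\<^sub>E A (?X v)))"
  proof (intro card_UN_disjoint J ballI impI)
    show "finite (Pi\<^sub>E A (?X v))" for v :: 'b
      using A J by (intro finite_PiE) auto
    fix v w :: 'b assume "v \<noteq> w"
    then show "Pi\<^sub>E A (?X v) \<inter> Pi\<^sub>E A (?X w) = {}"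
      using \<open>i \<in> A\<close> by (fastforce dest: PiE_mem)
  qed
  also have "\<dots> = (\<Sum>v\<in>J. card J ^ (card A - 2))"
  proof (intro sum.cong refl)
    fix v :: 'b
    have "card (Pi\<^sub>E A (?X v)) = (\<Prod>l\<in>A. if l \<in> {i, k} then 1 else card J)"
      using A by (simp add: card_PiE if_distrib cong: if_cong)
    also have "\<dots> = (\<Prod>l\<in>A - {i, k}. card J)"
      using A assms by (intro prod.mono_neutral_cong_right) auto
    also have "\<dots> = card J ^ (card A - 2)"
      using A assms by (simp add: card_Diff_subset numeral_2_eq_2)
    finally show "card (Pi\<^sub>E A (?X v)) = card J ^ (card A - 2)" .
  qed
  finally have *: "card {f \<in> A \<rightarrow>\<^sub>E J. f i = f k} = card J * card J ^ (card A - 2)"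
    by simp
  \<comment> \<open>Ensures that the natural subtraction \<open>card A - 2\<close> is not
    truncated.\<close>
  have "2 \<le> card A"
    using card_mono[of A "{i, k}"] A assms by auto
  then have "card A = Suc (Suc (card A - 2))"
    by simp
  then have "card J ^ card A = card J * (card J * card J ^ (card A - 2))"
    by (metis power_Suc)
  with * show ?thesis
    by simp
qed

lemma sum_PiE_fibre_card_squares_le:
  assumes n: "0 < n"
  shows "(\<Sum>f\<in>{..<n} \<rightarrow>\<^sub>E {..<n}. \<Sum>j<n. (real (fibre_card {..<n} f j))\<^sup>2)
    \<le> 2 * real n * real n ^ n"
proof -
  let ?F = "{..<n} \<rightarrow>\<^sub>E {..<n}"
  have fin: "finite ?F"
    by (intro finite_PiE) auto
  have c: "(\<Sum>f\<in>?F. of_bool (f i = f k)) = (if i = k then 1 else 1 / real n) * real n ^ n"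
    if "i < n" "k < n" for i k
  proof (cases "i = k")
    case False
    have "real (card {f \<in> ?F. f i = f k}) * real n = real n ^ n"
      using arg_cong[OF card_PiE_collision[of "{..<n}" "{..<n}" i k], of real] that False by simp
    then show ?thesis
      using fin False n by (simp add: Int_def field_simps)
  qed (simp add: card_PiE)
  have "(\<Sum>f\<in>?F. \<Sum>j<n. (real (fibre_card {..<n} f j))\<^sup>2)
      = (\<Sum>f\<in>?F. \<Sum>i<n. \<Sum>k<n. of_bool (f i = f k))"
    by (rule sum.cong[OF refl], rule sum_fibre_card_squares) auto
  also have "\<dots> = (\<Sum>i<n. \<Sum>k<n. \<Sum>f\<in>?F. of_bool (f i = f k))"
    by (subst sum.swap, intro sum.cong refl, subst sum.swap) simp
  also have "\<dots> = (\<Sum>i<n. \<Sum>k<n. (if i = k then 1 else 1 / real n) * real n ^ n)"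
    using c by (intro sum.cong refl) auto
  \<comment> \<open>Adding 1/n on the diagonal too removes the case split; the exact mean 2n - 1
    becomes 2n.\<close>
  also have "\<dots> \<le> (\<Sum>i<n. \<Sum>k<n. (of_bool (i = k) + 1 / real n) * real n ^ n)"
    by (intro sum_mono mult_right_mono) auto
  also have "\<dots> = 2 * real n * real n ^ n"
  proof -
    have "(\<Sum>k<n. (of_bool (i = k) + 1 / real n) * real n ^ n) = 2 * real n ^ n" if "i < n" for i
    proof -
      have "{..<n} \<inter> {k. i = k} = {i}"
        using that by auto
      then show ?thesis
        using n by (simp add: sum_distrib_right[symmetric] sum.distrib)
    qed
    then show ?thesis
      by simp
  qed
  finally show ?thesis .
qed

text \<open>The left-hand side is \<open>|A|!\<close> times the coefficient of \<open>x\<close> to the power \<open>|A|\<close> in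
  \<open>(\<Sum>b. g b x\<^sup>b / b!)\<close> to the power \<open>|J|\<close>; forgetting the constraint \<open>\<Sum>b\<^sub>j = |A|\<close> is the Poisson comparison.\<close>
lemma sum_prod_fibre_card_le:
  fixes g :: "nat \<Rightarrow> real"
  assumes J: "finite J" and g: "\<And>b. 0 \<le> g b" and A: "finite A" "card A \<le> N"
  shows "(\<Sum>f\<in>A \<rightarrow>\<^sub>E J. \<Prod>j\<in>J. g (fibre_card A f j))
    \<le> fact (card A) * (\<Sum>b\<le>N. g b / fact b) ^ card J"
  using J A
proof (induction J arbitrary: A)
  case empty
  show ?case
    by (cases "A = {}") (auto simp: PiE_empty_range)
next
  case (insert j J)
  let ?G = "\<Sum>b\<le>N. g b / fact b"
  have G: "0 \<le> ?G"
    using g by (intro sum_nonneg) auto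
  \<comment> \<open>A map into \<open>insert j J\<close> is the same as its fibre \<open>D\<close>
    over \<open>j\<close> together with a map from \<open>A - D\<close> to \<open>J\<close>;
    \<open>?glue\<close> and \<open>?cut\<close> are the two directions.\<close>
  let ?glue = "\<lambda>(D, f). \<lambda>i\<in>A. if i \<in> D then j else f i"
  let ?S = "Sigma (Pow A) (\<lambda>D. (A - D) \<rightarrow>\<^sub>E J)"
  let ?cut = "\<lambda>f. ({i \<in> A. f i = j}, restrict f (A - {i \<in> A. f i = j}))"
  have "(\<Sum>f\<in>A \<rightarrow>\<^sub>E insert j J. \<Prod>l\<in>insert j J. g (fibre_card A f l))
      = (\<Sum>(D, f)\<in>?S. g (card D) * (\<Prod>l\<in>J. g (fibre_card (A - D) f l)))"
  proof (rule sum.reindex_bij_witness[where i = ?glue and j = ?cut])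
    fix f assume f: "f \<in> A \<rightarrow>\<^sub>E insert j J"
    show "?glue (?cut f) = f"
      using f by (auto simp: fun_eq_iff PiE_iff extensional_def)
    show "?cut f \<in> ?S"
      using f by (auto simp: PiE_iff)
    have "fibre_card (A - {i \<in> A. f i = j}) (restrict f (A - {i \<in> A. f i = j})) l = fibre_card A f l"
      if "l \<in> J" for l
      unfolding fibre_card_def using that insert.hyps by (intro arg_cong[where f = card]) auto
    then show "(case ?cut f of (D, f) \<Rightarrow> g (card D) * (\<Prod>l\<in>J. g (fibre_card (A - D) f l)))
        = (\<Prod>l\<in>insert j J. g (fibre_card A f l))"
      using insert.hyps by (simp add: fibre_card_def[of A f j])
  next
    fix p assume p: "p \<in> ?S"
    obtain D f where [simp]: "p = (D, f)"
      by fastforce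
    have D: "D \<subseteq> A" and f: "f \<in> (A - D) \<rightarrow>\<^sub>E J"
      using p by auto
    have fj: "f i \<noteq> j" if "i \<in> A" "i \<notin> D" for i
      using PiE_mem[OF f, of i] that insert.hyps by auto
    have D': "{i \<in> A. (\<lambda>i\<in>A. if i \<in> D then j else f i) i = j} = D"
      using D fj by auto
    have "restrict (\<lambda>i\<in>A. if i \<in> D then j else f i) (A - D) = f"
      using f by (auto simp: fun_eq_iff PiE_iff extensional_def)
    with D' show "?cut (?glue p) = p"
      by (simp del: restrict_apply)
    show "?glue p \<in> A \<rightarrow>\<^sub>E insert j J"
      using D f by (auto simp: PiE_iff)
  qed
  also have "\<dots> = (\<Sum>D\<in>Pow A. g (card D) *
      (\<Sum>f\<in>(A - D) \<rightarrow>\<^sub>E J. \<Prod>l\<in>J. g (fibre_card (A - D) f l)))"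
    using insert.prems insert.hyps
    by (subst sum.Sigma[symmetric]) (auto intro!: finite_PiE simp: sum_distrib_left)
  also have "\<dots> \<le> (\<Sum>D\<in>Pow A. g (card D) * (fact (card (A - D)) * ?G ^ card J))"
  proof (intro sum_mono mult_left_mono g insert.IH)
    fix D
    show "finite (A - D)" "card (A - D) \<le> N"
      using insert.prems card_mono[of A "A - D"] by auto
  qed
  also have "\<dots> = (\<Sum>D\<in>Pow A. g (card D) * (fact (card A - card D) * ?G ^ card J))"
    using insert.prems by (intro sum.cong refl) (auto simp: card_Diff_subset finite_subset)
  also have "\<dots> = (\<Sum>b\<le>card A. \<Sum>D | D \<in> Pow A \<and> card D = b.
      g (card D) * (fact (card A - card D) * ?G ^ card J))"
    using insert.prems by (intro sum.group[symmetric]) (auto intro: card_mono)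
  also have "\<dots> = (\<Sum>b\<le>card A. real (card A choose b) * (g b * (fact (card A - b) * ?G ^ card J)))"
  proof (intro sum.cong refl)
    fix b
    have "(\<Sum>D | D \<in> Pow A \<and> card D = b. g (card D) * (fact (card A - card D) * ?G ^ card J))
        = (\<Sum>D | D \<in> Pow A \<and> card D = b. g b * (fact (card A - b) * ?G ^ card J))"
      by (intro sum.cong) auto
    then show "(\<Sum>D | D \<in> Pow A \<and> card D = b. g (card D) * (fact (card A - card D) * ?G ^ card J))
        = real (card A choose b) * (g b * (fact (card A - b) * ?G ^ card J))"
      using insert.prems by (simp add: n_subsets)
  qed
  also have "\<dots> = fact (card A) * ?G ^ card J * (\<Sum>b\<le>card A. g b / fact b)"
    unfolding sum_distrib_left
    by (intro sum.cong refl) (simp add: binomial_fact field_simps)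
  \<comment> \<open>The constraint on the total size is lost here. A common cutoff \<open>N\<close>
    lets the induction hypothesis give the same \<open>?G\<close> for every
    \<open>A - D\<close>.\<close>
  also have "\<dots> \<le> fact (card A) * ?G ^ card J * ?G"
    using insert.prems g G by (intro mult_left_mono sum_mono2) auto
  also have "\<dots> = fact (card A) * ?G ^ card (insert j J)"
    using insert.hyps by simp
  finally show ?case .
qed

subsection \<open>Exponential moments of the capped square\<close>

text \<open>The quotient b^b / b! is a single term of the series of exp b.\<close>

lemma power_self_le_exp_fact: "real b ^ b \<le> exp (real b) * fact b"
proof -
  have "(\<Sum>k\<in>{b}. real b ^ k /\<^sub>R fact k) \<le> exp (real b)"
    unfolding exp_def by (rule sum_le_suminf[OF summable_exp_generic]) auto
  then show ?thesis
    by (simp add: field_simps)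
qed

text \<open>The price of conditioning: n^n / (n! e^n) is the probability that a Poisson variable of
  mean n equals n. The induction step needs e \<le> (1 + 1/n)^(n+1), which is ln x \<le> x - 1 at x
  = n/(n+1).\<close>

lemma fact_exp_le_power:
  assumes "0 < n"
  shows "fact n * exp (real n) \<le> exp 1 * real n * real n ^ n"
  using assms
proof (induction n rule: nat_induct_non_zero)
  case (Suc n)
  have "1 - real n / real (n + 1) \<le> - ln (real n / real (n + 1))"
    using ln_le_minus_one[of "real n / real (n + 1)"] Suc.hyps by simp
  then have "1 \<le> real (n + 1) * ln (real (n + 1) / real n)"
    using Suc.hyps by (simp add: ln_div field_simps)
  then have "exp 1 \<le> exp (real (n + 1) * ln (real (n + 1) / real n))"
    by simp
  also have "\<dots> = (real (n + 1) / real n) ^ (n + 1)"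
    using Suc.hyps by (subst exp_of_nat_mult) simp
  finally have e: "exp 1 * real n ^ (n + 1) \<le> real (n + 1) ^ (n + 1)"
    using Suc.hyps by (simp add: power_divide field_simps del: power_Suc of_nat_Suc)
  have "fact (Suc n) * exp (real (Suc n)) = real (n + 1) * exp 1 * (fact n * exp (real n))"
    by (simp add: exp_add algebra_simps)
  also have "\<dots> \<le> real (n + 1) * exp 1 * (exp 1 * real n * real n ^ n)"
    using Suc.IH by (intro mult_left_mono) auto
  also have "\<dots> = exp 1 * real (n + 1) * (exp 1 * real n ^ (n + 1))"
    by simp
  also have "\<dots> \<le> exp 1 * real (n + 1) * real (n + 1) ^ (n + 1)"
    using e by (intro mult_left_mono) auto
  finally show ?case
    by simp
qed simp

text \<open>Dominates \<open>b\<^sup>2 exp (\<mu> h(b)) / b!\<close> uniformly in \<open>n\<close>.\<close>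
definition poisson_weight :: "nat \<Rightarrow> real" where
  "poisson_weight b = (real b)\<^sup>2 * exp (real b) / sqrt (fact b)"

lemma poisson_weight_nonneg: "0 \<le> poisson_weight b"
  by (simp add: poisson_weight_def)

lemma summable_poisson_weight: "summable poisson_weight"
proof (rule summable_ratio_test)
  show "(1/2::real) < 1"
    by simp
  \<comment> \<open>The ratio of consecutive terms is (1 + 1/b)^2 * e / sqrt (b + 1), with factors
    at most 4, 4 and 1/32; 1024 is 32 squared.\<close>
  fix b :: nat assume b: "1024 \<le> b"
  have e: "exp 1 \<le> (4::real)"
    using exp_le by simp
  have "(32::real) = sqrt 1024"
    by (rule real_sqrt_unique[symmetric]) auto
  also have "\<dots> \<le> sqrt (real (b + 1))"
    using b by (intro real_sqrt_le_mono) auto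
  finally have r: "(32::real) \<le> sqrt (real (b + 1))" .
  have "(real (Suc b))\<^sup>2 \<le> (2 * real b)\<^sup>2"
    using b by (intro power_mono) auto
  then have q: "(real (Suc b))\<^sup>2 \<le> 4 * (real b)\<^sup>2"
    by (simp add: power_mult_distrib)
  have "poisson_weight (Suc b) = (real (Suc b))\<^sup>2 * exp 1 / sqrt (real (b + 1)) * (exp (real b) / sqrt (fact b))"
    by (simp add: poisson_weight_def exp_add real_sqrt_mult)
  also have "\<dots> \<le> (4 * (real b)\<^sup>2) * 4 / 32 * (exp (real b) / sqrt (fact b))"
    using e q r by (intro mult_right_mono frac_le mult_mono) auto
  also have "\<dots> = 1/2 * poisson_weight b"
    by (simp add: poisson_weight_def)
  finally show "norm (poisson_weight (Suc b)) \<le> 1/2 * norm (poisson_weight b)"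
    by (simp add: poisson_weight_def)
qed

text \<open>The function \<open>h\<close>, with \<open>s\<close> standing for \<open>sqrt n\<close>.\<close>
definition capped_square :: "real \<Rightarrow> real \<Rightarrow> real" where
  "capped_square s b = min (b\<^sup>2 / s) b"

text \<open>With t = s/b \<ge> 1 the uncapped term is b (ln b + ln t) / t, and ln t \<le> t. Beyond
  s the cap b takes over, and ln s \<le> ln b suffices.\<close>

lemma capped_square_ln_le:
  assumes s: "1 \<le> s" and b: "1 \<le> b"
  shows "ln s * capped_square s b \<le> b * (ln b + 1)"
proof (cases "b \<le> s")
  case True
  define t where "t = s / b"
  have t: "1 \<le> t" "s = b * t"
    using True b by (auto simp: t_def field_simps)
  have "ln s * capped_square s b \<le> ln s * (b\<^sup>2 / s)"
    using s by (intro mult_left_mono) (auto simp: capped_square_def)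
  also have "\<dots> = b * (ln b / t + ln t / t)"
    using b t by (simp add: ln_mult field_simps power2_eq_square)
  also have "\<dots> \<le> b * (ln b + 1)"
  proof (intro mult_left_mono add_mono)
    show "ln b / t \<le> ln b"
      using b t divide_left_mono[of 1 t "ln b"] by simp
    show "ln t / t \<le> 1"
      using t ln_bound[of t] by simp
  qed (use b in auto)
  finally show ?thesis .
next
  case False
  have "ln s * capped_square s b \<le> ln s * b"
    using s by (intro mult_left_mono) (auto simp: capped_square_def)
  also have "\<dots> \<le> ln b * b"
    using False s b by (intro mult_right_mono) auto
  finally show ?thesis
    using b by (simp add: algebra_simps)
qed

text \<open>The factor 1/2 in the exponent yields only the square root of b!, so division by b!
  still leaves a summable sequence.\<close>

lemma exp_capped_square_le:
  assumes s: "1 \<le> s"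
  shows "exp (ln s / 2 * capped_square s (real b)) \<le> exp (real b) * sqrt (fact b)"
proof (cases "b = 0")
  case False
  then have b: "1 \<le> real b"
    by simp
  have "(exp (ln s / 2 * capped_square s (real b)))\<^sup>2 = exp (ln s * capped_square s (real b))"
    by (simp add: power2_eq_square exp_add[symmetric])
  also have "\<dots> \<le> exp (real b * (ln (real b) + 1))"
    using capped_square_ln_le[OF s b] by simp
  also have "\<dots> = real b ^ b * exp (real b)"
    using b by (simp add: algebra_simps exp_add exp_of_nat_mult)
  also have "\<dots> \<le> (exp (real b) * fact b) * exp (real b)"
    using power_self_le_exp_fact by (intro mult_right_mono) auto
  also have "\<dots> = (exp (real b) * sqrt (fact b))\<^sup>2"
    by (simp add: power_mult_distrib power2_eq_square)
  finally show ?thesis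
    by (rule power2_le_imp_le) auto
qed (simp add: capped_square_def)

lemma exp_sub_one_le: "exp z - 1 \<le> z * exp (z::real)"
proof -
  have "(1 - z) * exp z \<le> exp (- z) * exp z"
    using exp_ge_add_one_self[of "- z"] by (intro mult_right_mono) auto
  then show ?thesis
    by (simp add: exp_minus algebra_simps)
qed

text \<open>Expanding to first order by exp z \<le> 1 + z exp z separates the total mass e from an
  error of order ln s / s. Its n-th power with n = s^2 then costs exp (O(s ln s)), whereas a
  constant-factor bound would cost exp (O(n)).\<close>

lemma poisson_mgf_capped_square_le:
  assumes s: "1 \<le> s"
  shows "(\<Sum>b\<le>N. exp (ln s / 2 * capped_square s (real b)) / fact b)
    \<le> exp (1 + ln s / (2 * s) * suminf poisson_weight)"
proof -
  let ?m = "ln s / 2" and ?M = "suminf poisson_weight"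
  have M: "0 \<le> ?M"
    using summable_poisson_weight poisson_weight_nonneg by (intro suminf_nonneg) auto
  have "exp (?m * capped_square s (real b)) / fact b \<le> 1 / fact b + ln s / (2 * s) * poisson_weight b" for b
  proof -
    let ?z = "?m * capped_square s (real b)"
    have "exp ?z \<le> 1 + ?z * exp ?z"
      using exp_sub_one_le[of ?z] by simp
    \<comment> \<open>The linear factor is bounded by the branch b^2 / s, which supplies the gain
      1/s; the exponential is bounded uniformly in s.\<close>
    also have "\<dots> \<le> 1 + (?m * ((real b)\<^sup>2 / s)) * (exp (real b) * sqrt (fact b))"
      using s exp_capped_square_le[OF s, of b]
      by (intro add_mono mult_mono) (auto simp: capped_square_def)
    finally have "exp ?z / fact b \<le> (1 + (?m * ((real b)\<^sup>2 / s)) * (exp (real b) * sqrt (fact b))) / fact b"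
      by (intro divide_right_mono) auto
    also have "\<dots> = 1 / fact b + ln s / (2 * s) * poisson_weight b"
    proof -
      define q where "q = sqrt (fact b)"
      have "0 < q" "fact b = q * q"
        by (auto simp: q_def)
      then show ?thesis
        unfolding poisson_weight_def q_def[symmetric] using s by (simp add: field_simps)
    qed
    finally show ?thesis .
  qed
  then have "(\<Sum>b\<le>N. exp (?m * capped_square s (real b)) / fact b)
      \<le> (\<Sum>b\<le>N. 1 / fact b + ln s / (2 * s) * poisson_weight b)"
    by (intro sum_mono)
  also have "\<dots> = (\<Sum>b\<le>N. 1 / fact b) + ln s / (2 * s) * (\<Sum>b\<le>N. poisson_weight b)"
    by (simp add: sum.distrib sum_distrib_left)
  also have "\<dots> \<le> exp 1 + ln s / (2 * s) * ?M"
  proof (intro add_mono mult_left_mono)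
    have "(\<Sum>b\<le>N. 1 ^ b /\<^sub>R fact b) \<le> exp (1::real)"
      unfolding exp_def by (rule sum_le_suminf[OF summable_exp_generic]) auto
    then show "(\<Sum>b\<le>N. 1 / fact b) \<le> exp (1::real)"
      by (simp add: inverse_eq_divide)
    show "(\<Sum>b\<le>N. poisson_weight b) \<le> ?M"
      using summable_poisson_weight poisson_weight_nonneg by (intro sum_le_suminf) auto
  qed (use s in auto)
  also have "\<dots> \<le> exp 1 * (1 + ln s / (2 * s) * ?M)"
  proof -
    have "1 * (ln s / (2 * s) * ?M) \<le> exp 1 * (ln s / (2 * s) * ?M)"
      using s M by (intro mult_right_mono mult_nonneg_nonneg) auto
    then show ?thesis
      by (simp add: algebra_simps)
  qed
  also have "\<dots> \<le> exp 1 * exp (ln s / (2 * s) * ?M)"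
    by (intro mult_left_mono exp_ge_add_one_self) auto
  finally show ?thesis
    by (simp add: exp_add)
qed

text \<open>Either the buckets with at most \<open>s\<close> keys carry half of the sum of squares, or the others do,
  and then their total size is at least the square root of that half.\<close>
lemma sum_capped_square_ge:
  fixes b :: "'a \<Rightarrow> real"
  assumes J: "finite J" and b: "\<And>j. j \<in> J \<Longrightarrow> 0 \<le> b j" and s: "0 < s" and L: "1 \<le> L"
    and large: "2 * (L * s)\<^sup>2 \<le> (\<Sum>j\<in>J. (b j)\<^sup>2)"
  shows "L * s \<le> (\<Sum>j\<in>J. capped_square s (b j))"
proof -
  let ?l = "{j \<in> J. b j \<le> s}" and ?h = "{j \<in> J. \<not> b j \<le> s}"
  have split: "(\<Sum>j\<in>J. f j) = (\<Sum>j\<in>?l. f j) + (\<Sum>j\<in>?h. f j)" for f :: "'a \<Rightarrow> real"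
    using J by (subst sum.union_disjoint[symmetric]) (auto intro!: sum.cong)
  have low: "(\<Sum>j\<in>?l. capped_square s (b j)) = (\<Sum>j\<in>?l. (b j)\<^sup>2) / s"
    unfolding sum_divide_distrib
  proof (intro sum.cong refl)
    fix j assume j: "j \<in> ?l"
    then have "b j * b j \<le> b j * s"
      using b by (intro mult_left_mono) auto
    then show "capped_square s (b j) = (b j)\<^sup>2 / s"
      using s by (auto simp: capped_square_def power2_eq_square divide_simps min_def)
  qed
  have high: "(\<Sum>j\<in>?h. capped_square s (b j)) = (\<Sum>j\<in>?h. b j)"
  proof (intro sum.cong refl)
    fix j assume j: "j \<in> ?h"
    then have "s * b j \<le> b j * b j"
      using b by (intro mult_right_mono) auto
    then show "capped_square s (b j) = b j"
      using s by (auto simp: capped_square_def power2_eq_square divide_simps min_def mult.commute)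
  qed
  have low0: "0 \<le> (\<Sum>j\<in>?l. (b j)\<^sup>2) / s"
    using s by (intro divide_nonneg_pos sum_nonneg) auto
  have high0: "0 \<le> (\<Sum>j\<in>?h. b j)"
    using b by (intro sum_nonneg) auto
  have hsq: "(\<Sum>j\<in>?h. (b j)\<^sup>2) \<le> (\<Sum>j\<in>?h. b j)\<^sup>2"
  proof -
    have "(\<Sum>j\<in>?h. (b j)\<^sup>2) \<le> (\<Sum>j\<in>?h. b j * (\<Sum>k\<in>?h. b k))"
      unfolding power2_eq_square using b J
      by (intro sum_mono mult_left_mono member_le_sum) auto
    then show ?thesis
      by (simp add: power2_eq_square sum_distrib_right)
  qed
  consider "(L * s)\<^sup>2 \<le> (\<Sum>j\<in>?l. (b j)\<^sup>2)" | "(L * s)\<^sup>2 \<le> (\<Sum>j\<in>?h. (b j)\<^sup>2)"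
    using large split[of "\<lambda>j. (b j)\<^sup>2"] by linarith
  then show ?thesis
  proof cases
    case 1
    \<comment> \<open>This is where L \<ge> 1 enters, as L \<le> L^2.\<close>
    have "L * s \<le> (L * s)\<^sup>2 / s"
      using L s by (simp add: power2_eq_square)
    also have "\<dots> \<le> (\<Sum>j\<in>?l. (b j)\<^sup>2) / s"
      using 1 s by (intro divide_right_mono) auto
    finally show ?thesis
      using split[of "\<lambda>j. capped_square s (b j)"] low high high0 by linarith
  next
    case 2
    then have "L * s \<le> (\<Sum>j\<in>?h. b j)"
      using hsq high0 by (intro power2_le_imp_le[OF _ high0]) linarith
    then show ?thesis
      using split[of "\<lambda>j. capped_square s (b j)"] low high low0 by linarith
  qed
qed

subsection \<open>Tail bounds\<close>

text \<open>Markov's inequality by counting: on the event each map has weight at least exp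
  (\<open>?m * (L * s)\<close>), and the total weight is bounded by the Poisson comparison.\<close>

lemma prob_large_square_sum_le:
  fixes n :: nat
  defines "s \<equiv> sqrt (real n)"
  assumes n: "0 < n" and L: "1 \<le> L"
  shows "real (card {f \<in> {..<n} \<rightarrow>\<^sub>E {..<n}.
            2 * L\<^sup>2 * real n \<le> (\<Sum>j<n. (real (fibre_card {..<n} f j))\<^sup>2)}) / real n ^ n
    \<le> exp 1 * real n * exp (- (ln s / 2 * s * (L - suminf poisson_weight)))"
proof -
  let ?F = "{..<n} \<rightarrow>\<^sub>E {..<n}" and ?m = "ln s / 2" and ?M = "suminf poisson_weight"
  let ?E = "{f \<in> ?F. 2 * L\<^sup>2 * real n \<le> (\<Sum>j<n. (real (fibre_card {..<n} f j))\<^sup>2)}"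
  let ?g = "\<lambda>b. exp (?m * capped_square s (real b))"
  have s: "1 \<le> s" "s * s = real n"
    using n by (auto simp: s_def)
  have fin: "finite ?F"
    by (intro finite_PiE) auto
  have "real (card ?E) * exp (?m * (L * s)) = (\<Sum>f\<in>?E. exp (?m * (L * s)))"
    by simp
  also have "\<dots> \<le> (\<Sum>f\<in>?E. \<Prod>j<n. ?g (fibre_card {..<n} f j))"
  proof (rule sum_mono)
    fix f assume "f \<in> ?E"
    moreover have "2 * (L * s)\<^sup>2 = 2 * L\<^sup>2 * real n"
      using s(2) by (simp add: power_mult_distrib power2_eq_square[of s])
    ultimately have "2 * (L * s)\<^sup>2 \<le> (\<Sum>j<n. (real (fibre_card {..<n} f j))\<^sup>2)"
      by simp
    then have "L * s \<le> (\<Sum>j<n. capped_square s (real (fibre_card {..<n} f j)))"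
      using s L by (intro sum_capped_square_ge) auto
    then have "?m * (L * s) \<le> ?m * (\<Sum>j<n. capped_square s (real (fibre_card {..<n} f j)))"
      using s by (intro mult_left_mono) auto
    then have "exp (?m * (L * s)) \<le> exp (\<Sum>j<n. ?m * capped_square s (real (fibre_card {..<n} f j)))"
      by (simp add: sum_distrib_left)
    then show "exp (?m * (L * s)) \<le> (\<Prod>j<n. ?g (fibre_card {..<n} f j))"
      by (simp add: exp_sum)
  qed
  also have "\<dots> \<le> (\<Sum>f\<in>?F. \<Prod>j<n. ?g (fibre_card {..<n} f j))"
    using fin by (intro sum_mono2 prod_nonneg ballI) auto
  also have "\<dots> \<le> fact n * (\<Sum>b\<le>n. ?g b / fact b) ^ n"
    using sum_prod_fibre_card_le[of "{..<n}" ?g "{..<n}" n] by simp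
  also have "\<dots> \<le> fact n * exp (1 + ln s / (2 * s) * ?M) ^ n"
    using poisson_mgf_capped_square_le[OF s(1)]
    by (intro mult_left_mono power_mono sum_nonneg) auto
  also have "\<dots> = fact n * exp (real n) * exp (?m * s * ?M)"
  proof -
    \<comment> \<open>Since n = s * s, the error has the same scale as the Markov exponent, so only
      \<open>L - ?M\<close> survives.\<close>
    have "real n * (1 + ln s / (2 * s) * ?M) = real n + ?m * s * ?M"
      using s by (simp add: s(2)[symmetric] field_simps)
    then show ?thesis
      by (simp add: exp_of_nat_mult[symmetric] exp_add[symmetric] mult.assoc)
  qed
  also have "\<dots> \<le> exp 1 * real n * real n ^ n * exp (?m * s * ?M)"
    using fact_exp_le_power[OF n] by (intro mult_right_mono) auto
  finally have "real (card ?E) * exp (?m * (L * s)) \<le> exp 1 * real n * real n ^ n * exp (?m * s * ?M)" .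
  then have "real (card ?E) / real n ^ n \<le> exp 1 * real n * (exp (?m * s * ?M) / exp (?m * (L * s)))"
    using n by (simp add: field_simps)
  also have "exp (?m * s * ?M) / exp (?m * (L * s)) = exp (- (?m * s * (L - ?M)))"
    by (simp add: exp_diff[symmetric] right_diff_distrib diff_divide_distrib mult_ac)
  finally show ?thesis .
qed

text \<open>The n^(n - m) maps sending the first m points to 0 all have a fibre of size at least
  m.\<close>

lemma prob_large_square_sum_ge:
  assumes n: "0 < n" and m: "m \<le> n"
  shows "1 / real n ^ m \<le> real (card {f \<in> {..<n} \<rightarrow>\<^sub>E {..<n}.
            (real m)\<^sup>2 \<le> (\<Sum>j<n. (real (fibre_card {..<n} f j))\<^sup>2)}) / real n ^ n"
proof -
  let ?F = "{..<n} \<rightarrow>\<^sub>E {..<n}"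
  let ?E = "{f \<in> ?F. (real m)\<^sup>2 \<le> (\<Sum>j<n. (real (fibre_card {..<n} f j))\<^sup>2)}"
  let ?X = "\<lambda>i. if i \<in> {..<m} then {0} else {..<n}"
  have fin: "finite ?F"
    by (intro finite_PiE) auto
  have sub: "Pi\<^sub>E {..<n} ?X \<subseteq> ?E"
  proof
    fix f assume f: "f \<in> Pi\<^sub>E {..<n} ?X"
    have "f i \<in> {..<n}" if "i < n" for i
      using PiE_mem[OF f, of i] that n by (auto split: if_splits)
    then have F: "f \<in> ?F"
      using f by (auto simp: PiE_iff)
    have "f i = 0" if "i < m" for i
      using PiE_mem[OF f, of i] m that by simp
    then have "{..<m} \<subseteq> {i \<in> {..<n}. f i = 0}"
      using m by auto
    from card_mono[OF _ this] have "m \<le> fibre_card {..<n} f 0"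
      by (simp add: fibre_card_def)
    then have "(real m)\<^sup>2 \<le> (real (fibre_card {..<n} f 0))\<^sup>2"
      by (intro power_mono) auto
    also have "\<dots> \<le> (\<Sum>j<n. (real (fibre_card {..<n} f j))\<^sup>2)"
      using n by (intro member_le_sum) auto
    finally show "f \<in> ?E"
      using F by simp
  qed
  have "card (Pi\<^sub>E {..<n} ?X) = (\<Prod>i<n. if i \<in> {..<m} then 1 else n)"
    by (simp add: card_PiE if_distrib cong: if_cong)
  also have "\<dots> = (\<Prod>i\<in>{..<n} - {..<m}. n)"
    by (intro prod.mono_neutral_cong_right) auto
  also have "\<dots> = n ^ (n - m)"
    using m by (simp add: card_Diff_subset)
  finally have "n ^ (n - m) \<le> card ?E"
    using card_mono[OF _ sub] fin by simp
  then have "real n ^ (n - m) \<le> real (card ?E)"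
    by (simp flip: of_nat_power)
  then have "real n ^ (n - m) / real n ^ n \<le> real (card ?E) / real n ^ n"
    by (intro divide_right_mono) auto
  moreover have "real n ^ n = real n ^ (n - m) * real n ^ m"
    using m by (simp flip: power_add)
  ultimately show ?thesis
    using n by simp
qed

text \<open>Fixes one n at which the eventual time bounds already hold, so the probabilistic
  estimates are free of filters.\<close>

locale bounded_bucket_sort =
  fixes c\<^sub>1 c\<^sub>2 :: real and n :: nat and T :: "(nat \<Rightarrow> real) \<Rightarrow> real"
  assumes c: "0 < c\<^sub>1" "c\<^sub>1 \<le> c\<^sub>2" and n: "0 < n"
    and meas: "T \<in> borel_measurable (uniform_keys n)"
    and bounds: "\<And>x. x \<in> space (uniform_keys n) \<Longrightarrow>
        c\<^sub>1 * (real n + (\<Sum>j<n. (real (bucket_count n x j))\<^sup>2)) \<le> T x \<and>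
        T x \<le> c\<^sub>2 * (real n + (\<Sum>j<n. (real (bucket_count n x j))\<^sup>2))"
begin

sublocale prob_space "uniform_keys n"
  by (rule prob_space_uniform_keys)

definition square_sum :: "(nat \<Rightarrow> nat) \<Rightarrow> real" where
  "square_sum f = (\<Sum>j<n. (real (fibre_card {..<n} f j))\<^sup>2)"

lemma square_sum_nonneg: "0 \<le> square_sum f"
  by (simp add: square_sum_def sum_nonneg)

lemma time_bounds:
  assumes "x \<in> space (uniform_keys n)"
  shows "c\<^sub>1 * (real n + square_sum (bucket_index n x)) \<le> T x"
    and "T x \<le> c\<^sub>2 * (real n + square_sum (bucket_index n x))"
  using bounds[OF assms] bucket_count_eq_fibre_card[OF n assms] by (simp_all add: square_sum_def)

lemma expectation_nonneg: "0 \<le> expectation T"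
proof (rule Bochner_Integration.integral_nonneg)
  fix x assume x: "x \<in> space (uniform_keys n)"
  have "0 \<le> c\<^sub>1 * (real n + square_sum (bucket_index n x))"
    using c square_sum_nonneg by (intro mult_nonneg_nonneg add_nonneg_nonneg) auto
  with time_bounds(1)[OF x] show "0 \<le> T x"
    by linarith
qed

lemma expectation_le: "expectation T \<le> 3 * c\<^sub>2 * real n"
proof -
  let ?\<phi> = "\<lambda>f. c\<^sub>2 * (real n + square_sum f)"
  let ?F = "{..<n} \<rightarrow>\<^sub>E {..<n}"
  note I = has_bochner_integral_bucket_index[OF n, of ?\<phi>]
  \<comment> \<open>Only the dominating function has to be shown integrable for
    \<open>integral_mono'\<close>.\<close>
  have "expectation T \<le> expectation (\<lambda>x. ?\<phi> (bucket_index n x))"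
    using I time_bounds(2) c square_sum_nonneg
    by (intro integral_mono') (auto simp: has_bochner_integral_iff intro!: mult_nonneg_nonneg add_nonneg_nonneg)
  also have "\<dots> = (\<Sum>f\<in>?F. ?\<phi> f) / real n ^ n"
    using I by (rule has_bochner_integral_integral_eq)
  also have "(\<Sum>f\<in>?F. ?\<phi> f) = c\<^sub>2 * (real n * real n ^ n + (\<Sum>f\<in>?F. square_sum f))"
    by (simp add: sum_distrib_left[symmetric] sum.distrib card_PiE)
  also have "\<dots> \<le> c\<^sub>2 * (real n * real n ^ n + 2 * real n * real n ^ n)"
    using c sum_PiE_fibre_card_squares_le[OF n] by (simp add: square_sum_def)
  also have "\<dots> / real n ^ n = 3 * c\<^sub>2 * real n"
    using n by (simp add: field_simps)
  finally show ?thesis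
    by (simp add: divide_right_mono)
qed

definition tail_prob :: "real \<Rightarrow> real" where
  "tail_prob t = prob {x \<in> space (uniform_keys n). T x \<ge> expectation T + t}"

lemma tail_event: "{x \<in> space (uniform_keys n). T x \<ge> t} \<in> events"
  using meas by measurable

text \<open>As the mean is nonnegative, the event forces T \<ge> a n; the upper time bound then
  forces a square sum of at least 2 L^2 n.\<close>

lemma tail_prob_le:
  assumes L: "1 \<le> L" and a: "c\<^sub>2 * (2 * L\<^sup>2 + 1) \<le> a"
  shows "tail_prob (a * real n)
    \<le> exp 1 * real n * exp (- (ln (sqrt (real n)) / 2 * sqrt (real n) * (L - suminf poisson_weight)))"
proof -
  let ?P = "\<lambda>f. 2 * L\<^sup>2 * real n \<le> square_sum f"
  have "{x \<in> space (uniform_keys n). T x \<ge> expectation T + a * real n}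
      \<subseteq> {x \<in> space (uniform_keys n). ?P (bucket_index n x)}"
  proof clarify
    fix x assume x: "x \<in> space (uniform_keys n)" and T: "T x \<ge> expectation T + a * real n"
    have "c\<^sub>2 * (2 * L\<^sup>2 + 1) * real n \<le> a * real n"
      using a by (intro mult_right_mono) auto
    also have "\<dots> \<le> c\<^sub>2 * (real n + square_sum (bucket_index n x))"
      using T time_bounds(2)[OF x] expectation_nonneg by linarith
    finally have "c\<^sub>2 * ((2 * L\<^sup>2 + 1) * real n) \<le> c\<^sub>2 * (real n + square_sum (bucket_index n x))"
      by (simp only: mult.assoc)
    then show "?P (bucket_index n x)"
      using c by (simp add: algebra_simps)
  qed
  then have "tail_prob (a * real n) \<le> prob {x \<in> space (uniform_keys n). ?P (bucket_index n x)}"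
    unfolding tail_prob_def by (intro finite_measure_mono measure_bucket_index(1)[OF n])
  also have "\<dots> \<le> exp 1 * real n * exp (- (ln (sqrt (real n)) / 2 * sqrt (real n) * (L - suminf poisson_weight)))"
    unfolding measure_bucket_index(2)[OF n, of ?P] unfolding square_sum_def
    by (rule prob_large_square_sum_le[OF n L])
  finally show ?thesis .
qed

text \<open>The condition on \<open>m\<close> makes \<open>c\<^sub>1\<close> m^2 exceed the bound
  \<open>3 * c\<^sub>2 * real n\<close> on the mean by at least a n.\<close>

lemma tail_prob_ge:
  assumes m: "m \<le> n" "(3 * c\<^sub>2 + a) / c\<^sub>1 * real n \<le> (real m)\<^sup>2"
  shows "1 / real n ^ m \<le> tail_prob (a * real n)"
proof -
  let ?P = "\<lambda>f. (real m)\<^sup>2 \<le> square_sum f"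
  have "1 / real n ^ m \<le> prob {x \<in> space (uniform_keys n). ?P (bucket_index n x)}"
    unfolding measure_bucket_index(2)[OF n, of ?P] unfolding square_sum_def
    by (rule prob_large_square_sum_ge[OF n m(1)])
  also have "\<dots> \<le> tail_prob (a * real n)"
    unfolding tail_prob_def
  proof (intro finite_measure_mono tail_event subsetI CollectI conjI; clarify)
    fix x assume x: "x \<in> space (uniform_keys n)" and P: "?P (bucket_index n x)"
    have "(3 * c\<^sub>2 + a) * real n = c\<^sub>1 * ((3 * c\<^sub>2 + a) / c\<^sub>1 * real n)"
      using c by simp
    also have "\<dots> \<le> c\<^sub>1 * (real n + square_sum (bucket_index n x))"
      using c m(2) P by (intro mult_left_mono) auto
    also have "\<dots> \<le> T x"
      by (rule time_bounds(1)[OF x])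
    finally show "expectation T + a * real n \<le> T x"
      using expectation_le by (simp add: algebra_simps)
  qed
  finally show ?thesis .
qed

end

theorem theorem1:
  fixes c\<^sub>1 c\<^sub>2 :: real
  assumes "0 < c\<^sub>1" and "c\<^sub>1 \<le> c\<^sub>2"
  shows "\<exists>C>0. \<forall>T. b2_bucket_sort_time c\<^sub>1 c\<^sub>2 T \<longrightarrow>
           (\<forall>c>C. (\<lambda>n. tail_rate T n (c * real n)) \<in> \<Theta>(\<lambda>n. sqrt (real n) * log 2 (real n)))"
proof -
  \<comment> \<open>The excess 1 over the Poisson constant makes the decay exponent exactly sqrt n *
    ln n / 4. The resulting C is fixed before \<open>T\<close>.\<close>
  define L where "L = suminf poisson_weight + 1"
  have L: "1 \<le> L"
    using suminf_nonneg[OF summable_poisson_weight poisson_weight_nonneg] by (simp add: L_def)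
  define C where "C = c\<^sub>2 * (2 * L\<^sup>2 + 1)"
  have "0 < C"
    unfolding C_def using assms by (intro mult_pos_pos add_nonneg_pos) auto
  moreover have "(\<lambda>n. tail_rate T n (a * real n)) \<in> \<Theta>(\<lambda>n. sqrt (real n) * log 2 (real n))"
    if T: "b2_bucket_sort_time c\<^sub>1 c\<^sub>2 T" and a: "C < a" for T a
  proof -
    define r where "r = sqrt ((3 * c\<^sub>2 + a) / c\<^sub>1)"
    have r2: "r\<^sup>2 = (3 * c\<^sub>2 + a) / c\<^sub>1" and r: "0 < r"
      using assms a \<open>0 < C\<close> by (auto simp: r_def)
    have ev_bounds: "\<forall>\<^sub>F n in sequentially. \<forall>x \<in> space (uniform_keys n).
        c\<^sub>1 * (real n + (\<Sum>j<n. (real (bucket_count n x j))\<^sup>2)) \<le> T n x \<and>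
        T n x \<le> c\<^sub>2 * (real n + (\<Sum>j<n. (real (bucket_count n x j))\<^sup>2))"
      and meas: "T n \<in> borel_measurable (uniform_keys n)" for n
      using T by (auto simp: b2_bucket_sort_time_def)
    \<comment> \<open>Leaves room for the rounded-up number m of keys placed in bucket 0.\<close>
    have ev_r: "\<forall>\<^sub>F n in sequentially. r * sqrt (real n) + 1 \<le> real n"
      using r by real_asymp
    \<comment> \<open>Half of the exponent is given up to absorb the prefactor e n.\<close>
    have ev_ln: "\<forall>\<^sub>F n in sequentially.
        sqrt (real n) * ln (real n) / 8 \<le> sqrt (real n) * ln (real n) / 4 - ln (real n) - 1"
      by real_asymp
    have "\<forall>\<^sub>F n in sequentially.
        sqrt (real n) * ln (real n) / 8 \<le> tail_rate T n (a * real n) \<and>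
        tail_rate T n (a * real n) \<le> (r + 1) * (sqrt (real n) * ln (real n))"
      using ev_bounds ev_r ev_ln eventually_gt_at_top[of 0]
    proof eventually_elim
      case (elim n)
      interpret bounded_bucket_sort c\<^sub>1 c\<^sub>2 n "T n"
        using assms elim(1,4) meas by unfold_locales auto
      define m where "m = nat \<lceil>r * sqrt (real n)\<rceil>"
      have m: "r * sqrt (real n) \<le> real m" "real m \<le> r * sqrt (real n) + 1"
        using r by (auto simp: m_def)
      have "m \<le> n"
        using m(2) elim(3) elim(2) by linarith
      have "(r * sqrt (real n))\<^sup>2 \<le> (real m)\<^sup>2"
        using m(1) r by (intro power_mono) auto
      then have "(3 * c\<^sub>2 + a) / c\<^sub>1 * real n \<le> (real m)\<^sup>2"
        by (simp add: power_mult_distrib r2)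
      note ge = tail_prob_ge[OF \<open>m \<le> n\<close> this]
      have pos: "0 < 1 / real n ^ m"
        using n by simp
      \<comment> \<open>Positivity keeps the convention \<open>ln 0 = 0\<close> from interfering
        when logarithms are compared.\<close>
      have tail_pos: "0 < tail_prob (a * real n)"
        using ge pos by (rule order.strict_trans2[rotated])
      have rate: "tail_rate T n (a * real n) = - ln (tail_prob (a * real n))"
        by (simp add: tail_rate_def tail_prob_def)
      have "- ln (tail_prob (a * real n)) \<le> - ln (1 / real n ^ m)"
        using ge pos tail_pos by (intro le_imp_neg_le ln_le_cancel_iff[THEN iffD2])
      also have "\<dots> = real m * ln (real n)"
        using n by (simp add: ln_div ln_realpow)
      \<comment> \<open>Rounding up costs at most 1, which is at most sqrt n.\<close>
      also have "\<dots> \<le> (r * sqrt (real n) + sqrt (real n)) * ln (real n)"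
        using m(2) n by (intro mult_right_mono) (auto intro: order_trans)
      finally have upper: "- ln (tail_prob (a * real n)) \<le> (r + 1) * (sqrt (real n) * ln (real n))"
        by (simp add: algebra_simps)
      have "tail_prob (a * real n)
          \<le> exp 1 * real n * exp (- (ln (sqrt (real n)) / 2 * sqrt (real n) * (L - suminf poisson_weight)))"
        using L a by (intro tail_prob_le) (auto simp: C_def)
      also have "\<dots> = exp 1 * exp (ln (real n)) * exp (- (sqrt (real n) * ln (real n) / 4))"
        using n by (simp add: L_def ln_sqrt mult_ac)
      also have "\<dots> = exp (1 + ln (real n) - sqrt (real n) * ln (real n) / 4)"
        by (simp only: exp_add[symmetric]) simp
      finally have "ln (tail_prob (a * real n)) \<le> 1 + ln (real n) - sqrt (real n) * ln (real n) / 4"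
        using tail_pos by (metis exp_gt_zero ln_exp ln_le_cancel_iff)
      with upper elim(3) show ?case
        unfolding rate by linarith
    qed
    then have "\<forall>\<^sub>F n in sequentially.
        1/8 * norm (sqrt (real n) * ln (real n)) \<le> norm (tail_rate T n (a * real n)) \<and>
        norm (tail_rate T n (a * real n)) \<le> (r + 1) * norm (sqrt (real n) * ln (real n))"
      using eventually_gt_at_top[of 0]
    proof eventually_elim
      case (elim n)
      have "0 \<le> sqrt (real n) * ln (real n)"
        using elim(2) by simp
      with elim(1) show ?case
        by auto
    qed
    then have "(\<lambda>n. tail_rate T n (a * real n)) \<in> \<Theta>(\<lambda>n. sqrt (real n) * ln (real n))"
      using r by (intro bigthetaI'[of "1/8" "r + 1"]) auto
    also have "(\<lambda>n. sqrt (real n) * ln (real n)) \<in> \<Theta>(\<lambda>n. sqrt (real n) * log 2 (real n))"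
      by real_asymp
    finally show ?thesis .
  qed
  ultimately show ?thesis
    by blast
qed

end
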